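(* (Height reduction) Let $\mathcal{A}$ be a unital associative algebra over $\mathbb{Q}$, $\mathcal{C}\subseteq\mathcal{A}$ a commutative subalgebra, $\mathcal{I}$ the Lie idealiser of $\mathcal{C}$ in $\mathcal{A}$, and $d\in\mathcal{I}\setminus\mathcal{C}$. For any commutator $C$ featuring the letters $a_i\in\mathfrak{G}_{k_i}$, $i=1,\dots,n$, $$\mathrm{ht}\bigl(C(a_1,\dots,a_n)\bigr)\le \sum_{i=1}^n k_i-n+1.$$
   Context: The commutator is $[a,b]=a\cdot b-b\cdot a$; a commutator featuring the letters $a_1,\dots,a_n$ is a nested commutator (with any bracketing) in these $n$ letters. The Lie idealiser of $\mathcal{C}$ in $\mathcal{A}$ is $\mathcal{I}=\{d\in\mathcal{A}: [d,\mathcal{C}]\subseteq\mathcal{C}\}$. For $x\in\mathcal{C}$, the fixed $d\in\mathcal{I}\setminus\mathcal{C}$ and an integer $k\ge 0$, $\langle x\rangle_k=\tfrac12(x\cdot d^k+d^k\cdot x)$, with $d^0=1_{\mathcal{A}}$, and $\mathfrak{F}_k$ is the linear space $\{\langle x\rangle_k: x\in\mathcal{C}\}$. For an integer $m\ge 0$, $\mathfrak{G}_m=\bigoplus_{k\le m}\mathfrak{F}_k$ (direct sum). The height of a term in $\mathfrak{G}_m$ is defined by $\mathrm{ht}\bigl(\sum_{k=0}^{m}\langle x_k\rangle_k\bigr)=m$ if $x_m$ is non-zero; the height of $0$ is defined to be $-1$, this being the only term with negative height.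
   Formalization: The bound is the maximum of -1 and the stated sum, since ht(0) = -1 makes the literal bound false below -1 (e.g. n = 3, all k_i = 0); there the commutator is 0. Where the sum of the F_k is not direct, height means the least top index over representations. *)

theory Defs
  imports Complex_Main
begin

locale rat_algebra = vector_space scale
  for scale :: "rat \<Rightarrow> 'a::ring_1 \<Rightarrow> 'a" +
  assumes scale_mult_left: "scale r x * y = scale r (x * y)"
    and scale_mult_right: "x * scale r y = scale r (x * y)"

text \<open>A subalgebra is not required to contain the unit of the ambient algebra.\<close>

definition subalgebra :: "(rat \<Rightarrow> 'a::ring_1 \<Rightarrow> 'a) \<Rightarrow> 'a set \<Rightarrow> bool" where
  "subalgebra scale C \<longleftrightarrow> module.subspace scale C \<and> (\<forall>x\<in>C. \<forall>y\<in>C. x * y \<in> C)"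

definition commutative_subalgebra :: "(rat \<Rightarrow> 'a::ring_1 \<Rightarrow> 'a) \<Rightarrow> 'a set \<Rightarrow> bool" where
  "commutative_subalgebra scale C \<longleftrightarrow> subalgebra scale C \<and> (\<forall>x\<in>C. \<forall>y\<in>C. x * y = y * x)"

definition commutator :: "'a::ring_1 \<Rightarrow> 'a \<Rightarrow> 'a" where
  "commutator a b = a * b - b * a"

definition lie_idealiser :: "'a::ring_1 set \<Rightarrow> 'a set" where
  "lie_idealiser C = {d. \<forall>c\<in>C. commutator d c \<in> C}"

definition sym_term :: "(rat \<Rightarrow> 'a::ring_1 \<Rightarrow> 'a) \<Rightarrow> 'a \<Rightarrow> nat \<Rightarrow> 'a \<Rightarrow> 'a" where
  "sym_term scale d k x = scale (1/2) (x * d ^ k + d ^ k * x)"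

definition F_space :: "(rat \<Rightarrow> 'a::ring_1 \<Rightarrow> 'a) \<Rightarrow> 'a set \<Rightarrow> 'a \<Rightarrow> nat \<Rightarrow> 'a set" where
  "F_space scale C d k = sym_term scale d k ` C"

definition G_space :: "(rat \<Rightarrow> 'a::ring_1 \<Rightarrow> 'a) \<Rightarrow> 'a set \<Rightarrow> 'a \<Rightarrow> nat \<Rightarrow> 'a set" where
  "G_space scale C d m = {\<Sum>k\<le>m. f k | f. \<forall>k\<le>m. f k \<in> F_space scale C d k}"

definition height_rep ::
  "(rat \<Rightarrow> 'a::ring_1 \<Rightarrow> 'a) \<Rightarrow> 'a set \<Rightarrow> 'a \<Rightarrow> 'a \<Rightarrow> nat \<Rightarrow> (nat \<Rightarrow> 'a) \<Rightarrow> bool" where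
  "height_rep scale C d y m x \<longleftrightarrow>
     (\<forall>k\<le>m. x k \<in> C) \<and> x m \<noteq> 0 \<and> y = (\<Sum>k\<le>m. sym_term scale d k (x k))"

text \<open>
  If an element determines its coefficients (the sum of the spaces \<open>F_space scale C d k\<close> is
  direct and each \<open>sym_term scale d k\<close> is injective on \<open>C\<close>), then every representation with
  nonzero top coefficient has the same top index, and this index is the height; see
  \<open>height_eq_top_index\<close> below. In an arbitrary algebra representations need not be unique
  (for instance if \<open>d\<close> is nilpotent), and the height is the least top index. The value is
  meaningful only on the union of the spaces \<open>G_space scale C d m\<close>.
\<close>

definition height :: "(rat \<Rightarrow> 'a::ring_1 \<Rightarrow> 'a) \<Rightarrow> 'a set \<Rightarrow> 'a \<Rightarrow> 'a \<Rightarrow> int" where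
  "height scale C d y =
     (if y = 0 then -1 else int (LEAST m. \<exists>x. height_rep scale C d y m x))"

lemma height_eq_top_index:
  fixes scale :: "rat \<Rightarrow> 'a::ring_1 \<Rightarrow> 'a"
  assumes alg: "rat_algebra scale" and C: "subalgebra scale C"
    and unique: "\<And>N x. (\<forall>k\<le>N. x k \<in> C) \<Longrightarrow> (\<Sum>k\<le>N. sym_term scale d k (x k)) = 0
                  \<Longrightarrow> (\<forall>k\<le>N. x k = 0)"
    and rep: "height_rep scale C d y m x"
  shows "height scale C d y = int m"
proof -
  interpret rat_algebra scale by (fact alg)
  have sub: "subspace C" using C by (simp add: subalgebra_def)
  have st0: "sym_term scale d k 0 = 0" for k by (simp add: sym_term_def)
  have stdiff: "sym_term scale d k (u - v) = sym_term scale d k u - sym_term scale d k v" for k u v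
    by (simp add: sym_term_def scale_right_diff_distrib[symmetric] algebra_simps)
  have ext: "(\<Sum>k\<le>p. sym_term scale d k (u k)) =
      (\<Sum>k\<le>N. sym_term scale d k (if k \<le> p then u k else 0))" if "p \<le> N" for p N u
  proof -
    have "(\<Sum>k\<le>N. sym_term scale d k (if k \<le> p then u k else 0)) =
      (\<Sum>k\<le>p. sym_term scale d k (if k \<le> p then u k else 0))"
      by (rule sum.mono_neutral_right) (use that st0 in auto)
    then show ?thesis by simp
  qed
  have le: "p \<le> q" if p: "height_rep scale C d y p u" and q: "height_rep scale C d y q v" for p q u v
  proof (rule ccontr)
    assume n: "\<not> p \<le> q"
    let ?w = "\<lambda>k. u k - (if k \<le> q then v k else 0)"
    have "\<forall>k\<le>p. ?w k \<in> C"
      using p q subspace_diff[OF sub] by (auto simp: height_rep_def)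
    moreover have "(\<Sum>k\<le>p. sym_term scale d k (?w k)) = 0"
      using p q ext[of q p v] n by (simp add: stdiff sum_subtractf height_rep_def)
    ultimately have "?w p = 0" using unique[of p ?w] by blast
    then show False using n p by (simp add: height_rep_def)
  qed
  have "y \<noteq> 0" using rep unique[of m x] by (auto simp: height_rep_def)
  moreover have "(LEAST m. \<exists>x. height_rep scale C d y m x) = m"
    by (rule Least_equality) (use rep le in blast)+
  ultimately show ?thesis by (simp add: height_def)
qed

text \<open>Bracketings with leaves labelled by indices of letters.\<close>

datatype bracketing = Letter nat | Bracket bracketing bracketing

primrec letters :: "bracketing \<Rightarrow> nat list" where
  "letters (Letter i) = [i]"
| "letters (Bracket u v) = letters u @ letters v"

primrec eval_commutator :: "(nat \<Rightarrow> 'a::ring_1) \<Rightarrow> bracketing \<Rightarrow> 'a" where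
  "eval_commutator a (Letter i) = a i"
| "eval_commutator a (Bracket u v) = commutator (eval_commutator a u) (eval_commutator a v)"

text \<open>Every letter with index in \<open>{1..n}\<close> occurs exactly once, in any order.\<close>

definition features :: "bracketing \<Rightarrow> nat \<Rightarrow> bool" where
  "features W n \<longleftrightarrow> distinct (letters W) \<and> set (letters W) = {1..n}"

end

theory Submission
  imports Defs
begin

text \<open>
  Moving powers of \<open>d\<close> to the right by \<open>d * x = x * d + [d, x]\<close> with \<open>[d, x] \<in> C\<close> shows that
  \<open>\<langle>x\<rangle>\<^sub>k\<close> and \<open>x * d ^ k\<close> agree up to terms of lower degree in \<open>d\<close>, so \<open>\<GG>\<^sub>m\<close> is also the space
  of all sums of \<open>x * d ^ k\<close> with \<open>x \<in> C\<close>, \<open>k \<le> m\<close>. In this form the leading terms of \<open>a * b\<close>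
  and \<open>b * a\<close> cancel since \<open>C\<close> is commutative, so each bracket lowers the degree by one.
\<close>

text \<open>
  The index is a strict bound for the exponent of \<open>d\<close>: \<open>normal_space C d (Suc m)\<close> is \<open>\<GG>\<^sub>m\<close>, and
  \<open>normal_space C d 0\<close> consists of the elements of height \<open>-1\<close>.
\<close>

primrec normal_space :: "'a::ring_1 set \<Rightarrow> 'a \<Rightarrow> nat \<Rightarrow> 'a set" where
  "normal_space C d 0 = {0}"
| "normal_space C d (Suc N) = {x * d ^ N + z | x z. x \<in> C \<and> z \<in> normal_space C d N}"

locale idealised_algebra = rat_algebra scale
  for scale :: "rat \<Rightarrow> 'a::ring_1 \<Rightarrow> 'a" +
  fixes C :: "'a set" and d :: 'a
  assumes comm_subalg: "commutative_subalgebra scale C"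
    and idealiser: "d \<in> lie_idealiser C"
begin

abbreviation "NS \<equiv> normal_space C d"

lemma subspace_C: "subspace C"
  using comm_subalg by (simp add: commutative_subalgebra_def subalgebra_def)

lemma mult_C: "x \<in> C \<Longrightarrow> y \<in> C \<Longrightarrow> x * y \<in> C"
  using comm_subalg by (simp add: commutative_subalgebra_def subalgebra_def)

lemma commute_C: "x \<in> C \<Longrightarrow> y \<in> C \<Longrightarrow> x * y = y * x"
  using comm_subalg by (simp add: commutative_subalgebra_def)

lemma derivation_C: "x \<in> C \<Longrightarrow> d * x - x * d \<in> C"
  using idealiser by (simp add: lie_idealiser_def commutator_def)

section \<open>Degree filtration and its behaviour under products\<close>

lemma normal_space_SucI: "x \<in> C \<Longrightarrow> z \<in> NS N \<Longrightarrow> x * d ^ N + z \<in> NS (Suc N)"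
  by auto

lemma subspace_normal_space: "subspace (NS N)"
proof (induction N)
  case 0
  show ?case by (simp add: subspace_def)
next
  case (Suc N)
  show ?case
  proof (rule subspaceI)
    show "0 \<in> NS (Suc N)"
      using normal_space_SucI[OF subspace_0[OF subspace_C] subspace_0[OF Suc]] by simp
  next
    fix u v assume "u \<in> NS (Suc N)" "v \<in> NS (Suc N)"
    then obtain x y z w where *: "x \<in> C" "y \<in> C" "z \<in> NS N" "w \<in> NS N"
      and uv: "u = x * d ^ N + z" "v = y * d ^ N + w" by auto
    have "u + v = (x + y) * d ^ N + (z + w)" by (simp add: uv algebra_simps)
    then show "u + v \<in> NS (Suc N)"
      using * by (metis normal_space_SucI subspace_add Suc subspace_C)
  next
    fix c u assume "u \<in> NS (Suc N)"
    then obtain x z where *: "x \<in> C" "z \<in> NS N" and u: "u = x * d ^ N + z" by auto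
    have "scale c u = scale c x * d ^ N + scale c z"
      by (simp add: u scale_right_distrib scale_mult_left)
    then show "scale c u \<in> NS (Suc N)"
      using * by (metis normal_space_SucI subspace_scale Suc subspace_C)
  qed
qed

lemmas normal_space_0 = subspace_0[OF subspace_normal_space]
lemmas normal_space_add = subspace_add[OF subspace_normal_space]
lemmas normal_space_diff = subspace_diff[OF subspace_normal_space]
lemmas normal_space_scale = subspace_scale[OF subspace_normal_space]

lemma normal_space_mono: "M \<le> N \<Longrightarrow> NS M \<subseteq> NS N"
proof (induction rule: dec_induct)
  case (step N)
  have "NS N \<subseteq> NS (Suc N)"
    using normal_space_SucI[OF subspace_0[OF subspace_C], of _ N] by auto
  with step.IH show ?case by blast
qed simp

lemma monomial_in_normal_space: "x \<in> C \<Longrightarrow> x * d ^ k \<in> NS (Suc k)"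
  using normal_space_SucI[OF _ normal_space_0, of x k] by simp

lemma mult_left_C_normal_space: "x \<in> C \<Longrightarrow> z \<in> NS N \<Longrightarrow> x * z \<in> NS N"
proof (induction N arbitrary: z)
  case (Suc N)
  from Suc.prems obtain y w where *: "y \<in> C" "w \<in> NS N" and z: "z = y * d ^ N + w" by auto
  have "x * z = (x * y) * d ^ N + x * w" by (simp add: z algebra_simps)
  then show ?case using * Suc by (metis normal_space_SucI mult_C)
qed simp

lemma mult_right_d_normal_space: "z \<in> NS N \<Longrightarrow> z * d \<in> NS (Suc N)"
proof (induction N arbitrary: z)
  case (Suc N)
  from Suc.prems obtain y w where *: "y \<in> C" "w \<in> NS N" and z: "z = y * d ^ N + w" by auto
  have "z * d = y * d ^ Suc N + w * d" by (simp add: z algebra_simps power_commutes)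
  then show ?case using * Suc.IH by (metis normal_space_SucI)
qed (use normal_space_0[of "Suc 0"] in simp)

lemma mult_left_d_normal_space: "z \<in> NS N \<Longrightarrow> d * z \<in> NS (Suc N)"
proof (induction N arbitrary: z)
  case (Suc N)
  from Suc.prems obtain y w where *: "y \<in> C" "w \<in> NS N" and z: "z = y * d ^ N + w" by auto
  \<comment> \<open>Here the idealiser enters: \<open>d * y = y * d + [d, y]\<close> with
    \<open>[d, y]\<close> in \<open>C\<close>, so the correction \<open>[d, y] * d ^ N\<close> stays
    one degree below the top.\<close>
  have "d * z = y * d ^ Suc N + ((d * y - y * d) * d ^ N + d * w)"
    by (simp add: z algebra_simps)
  moreover have "(d * y - y * d) * d ^ N + d * w \<in> NS (Suc N)"
    using * Suc.IH by (intro normal_space_add monomial_in_normal_space derivation_C)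
  ultimately show ?case using * by (metis normal_space_SucI)
qed (use normal_space_0[of "Suc 0"] in simp)

lemma mult_right_power_normal_space: "z \<in> NS N \<Longrightarrow> z * d ^ k \<in> NS (N + k)"
proof (induction k)
  case (Suc k)
  have "z * d ^ Suc k = z * d ^ k * d" by (simp add: power_commutes mult.assoc)
  then show ?case using mult_right_d_normal_space[OF Suc.IH[OF Suc.prems]] by simp
qed simp

section \<open>Commutators lower the degree\<close>

lemma commutator_power_normal_space: "x \<in> C \<Longrightarrow> d ^ k * x - x * d ^ k \<in> NS k"
proof (induction k)
  case (Suc k)
  \<comment> \<open>Leibniz rule for \<open>[d * d ^ k, x]\<close>: left multiplication by
    \<open>d\<close> raises the bound \<open>k\<close> by one, and \<open>[d, x]\<close> lies in
    \<open>C\<close>, so both summands lie in \<open>NS (Suc k)\<close>.\<close>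
  have "d ^ Suc k * x - x * d ^ Suc k
      = d * (d ^ k * x - x * d ^ k) + (d * x - x * d) * d ^ k"
    by (simp add: algebra_simps)
  then show ?case
    using Suc normal_space_add mult_left_d_normal_space monomial_in_normal_space derivation_C
    by metis
qed simp

lemma commutator_monomials:
  assumes "x \<in> C" "y \<in> C"
  shows "commutator (x * d ^ p) (y * d ^ q) \<in> NS (p + q)"
proof -
  \<comment> \<open>Equality of the two leading terms, associated to the right as
    \<open>algebra_simps\<close> does, so that they cancel in the next step.\<close>
  have "x * (y * d ^ (p + q)) = y * (x * d ^ (p + q))"
    using commute_C[OF assms] by (simp add: mult.assoc[symmetric])
  then have "commutator (x * d ^ p) (y * d ^ q)
      = x * (d ^ p * y - y * d ^ p) * d ^ q - y * (d ^ q * x - x * d ^ q) * d ^ p"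
    by (simp add: commutator_def algebra_simps flip: power_add)
  moreover have "x * (d ^ p * y - y * d ^ p) * d ^ q \<in> NS (p + q)"
    by (intro mult_right_power_normal_space mult_left_C_normal_space
        commutator_power_normal_space assms)
  moreover have "y * (d ^ q * x - x * d ^ q) * d ^ p \<in> NS (q + p)"
    by (intro mult_right_power_normal_space mult_left_C_normal_space
        commutator_power_normal_space assms)
  ultimately show ?thesis by (simp add: normal_space_diff add.commute)
qed

lemma commutator_monomial_normal_space:
  "x \<in> C \<Longrightarrow> v \<in> NS q \<Longrightarrow> commutator (x * d ^ p) v \<in> NS (p + q - 1)"
proof (induction q arbitrary: v)
  case 0
  then show ?case using normal_space_0 by (simp add: commutator_def)
next
  case (Suc q)
  from Suc.prems obtain y w where *: "y \<in> C" "w \<in> NS q" and v: "v = y * d ^ q + w" by auto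
  have "commutator (x * d ^ p) v
      = commutator (x * d ^ p) (y * d ^ q) + commutator (x * d ^ p) w"
    by (simp add: v commutator_def algebra_simps)
  moreover have "commutator (x * d ^ p) w \<in> NS (p + q)"
    by (rule subsetD[OF normal_space_mono Suc.IH[OF Suc.prems(1) *(2)]]) arith
  ultimately show ?case
    using commutator_monomials[OF Suc.prems(1) *(1)] by (simp add: normal_space_add)
qed

text \<open>Strict bounds \<open>p\<close>, \<open>q\<close> mean degrees at most
  \<open>p - 1\<close>, \<open>q - 1\<close>; the bracket loses one more degree, giving the strict
  bound \<open>p + q - 2\<close>. Truncated subtraction is harmless: for \<open>p + q < 2\<close>
  one factor is zero, for \<open>p = q = 1\<close> both lie in \<open>C\<close> and commute.\<close>

lemma commutator_normal_space:
  "u \<in> NS p \<Longrightarrow> v \<in> NS q \<Longrightarrow> commutator u v \<in> NS (p + q - 2)"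
proof (induction p arbitrary: u)
  case 0
  then show ?case using normal_space_0 by (simp add: commutator_def)
next
  case (Suc p)
  from Suc.prems obtain x z where *: "x \<in> C" "z \<in> NS p" and u: "u = x * d ^ p + z" by auto
  have "commutator u v = commutator (x * d ^ p) v + commutator z v"
    by (simp add: u commutator_def algebra_simps)
  moreover have "commutator z v \<in> NS (p + q - 1)"
    by (rule subsetD[OF normal_space_mono Suc.IH[OF *(2) Suc.prems(2)]]) arith
  ultimately show ?case
    using commutator_monomial_normal_space[OF *(1) Suc.prems(2), of p]
    by (simp add: normal_space_add)
qed

text \<open>A bracket turns bounds \<open>s\<close>, \<open>t\<close> into \<open>s + t - 2\<close>,
  so bound minus 2 is additive, and a letter contributes \<open>k i - 1\<close>. The sum is taken in
  the integers because letters from \<open>C\<close> contribute \<open>-1\<close>.\<close>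

lemma eval_commutator_normal_space:
  assumes "\<And>i. i \<in> set (letters W) \<Longrightarrow> a i \<in> NS (Suc (k i))"
  shows "eval_commutator a W \<in> NS (nat ((\<Sum>i\<leftarrow>letters W. int (k i) - 1) + 2))"
  using assms
proof (induction W)
  case (Letter i)
  then show ?case by (simp add: nat_add_distrib del: normal_space.simps)
next
  case (Bracket U V)
  define s t where "s = (\<Sum>i\<leftarrow>letters U. int (k i) - 1) + 2"
    and "t = (\<Sum>i\<leftarrow>letters V. int (k i) - 1) + 2"
  have U: "eval_commutator a U \<in> NS (nat s)" and V: "eval_commutator a V \<in> NS (nat t)"
    using Bracket by (simp_all add: s_def t_def)
  have "commutator (eval_commutator a U) (eval_commutator a V) \<in> NS (nat (s + t - 2))"
  \<comment> \<open>If \<open>s\<close> is negative, \<open>nat s\<close> forgets the deficit and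
    \<open>nat s + nat t - 2\<close> can be too large; but then that factor lies in
    \<open>NS 0\<close>, so the bracket vanishes.\<close>
  proof (cases "s \<le> 0 \<or> t \<le> 0")
    case True
    then have "eval_commutator a U = 0 \<or> eval_commutator a V = 0" using U V by auto
    then show ?thesis using normal_space_0 by (auto simp: commutator_def)
  next
    case False
    then have "nat s + nat t - 2 = nat (s + t - 2)" by arith
    then show ?thesis using commutator_normal_space[OF U V] by simp
  qed
  then show ?case by (simp add: s_def t_def algebra_simps)
qed

section \<open>Symmetrised terms against monomials\<close>

lemma sym_term_diff_monomial:
  assumes "x \<in> C"
  shows "sym_term scale d k x - x * d ^ k \<in> NS k"
proof -
  have half: "x * d ^ k = scale (1/2) (x * d ^ k + x * d ^ k)"
    using scale_left_distrib[of "1/2" "1/2" "x * d ^ k"] by (simp add: scale_right_distrib)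
  \<comment> \<open>The discrepancy is half of \<open>[d ^ k, x]\<close>, which has lower
    degree.\<close>
  have "sym_term scale d k x - x * d ^ k = scale (1/2) (d ^ k * x - x * d ^ k)"
    by (subst half) (simp add: sym_term_def flip: scale_right_diff_distrib)
  then show ?thesis using commutator_power_normal_space[OF assms] normal_space_scale by metis
qed

lemma sum_sym_terms_normal_space:
  "(\<forall>k<N. x k \<in> C) \<Longrightarrow> (\<Sum>k<N. sym_term scale d k (x k)) \<in> NS N"
proof (induction N)
  case (Suc N)
  have "(\<Sum>k<Suc N. sym_term scale d k (x k)) = x N * d ^ N
      + ((sym_term scale d N (x N) - x N * d ^ N) + (\<Sum>k<N. sym_term scale d k (x k)))"
    by simp
  then show ?case
    using Suc by (metis normal_space_SucI normal_space_add sym_term_diff_monomial less_Suc_eq)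
qed simp

text \<open>The passage between the two kinds of sums is triangular: keep the top coefficient
  \<open>y\<close>, push the lower-degree discrepancy into the remainder, and recurse.\<close>

lemma normal_space_sym_terms:
  "z \<in> NS N \<Longrightarrow> \<exists>x. (\<forall>k<N. x k \<in> C) \<and> z = (\<Sum>k<N. sym_term scale d k (x k))"
proof (induction N arbitrary: z)
  case (Suc N)
  from Suc.prems obtain y w where y: "y \<in> C" and w: "w \<in> NS N" and z: "z = y * d ^ N + w"
    by auto
  have "w - (sym_term scale d N y - y * d ^ N) \<in> NS N"
    by (intro normal_space_diff w sym_term_diff_monomial y)
  with Suc.IH obtain x where x: "\<forall>k<N. x k \<in> C"
    and eq: "w - (sym_term scale d N y - y * d ^ N) = (\<Sum>k<N. sym_term scale d k (x k))"
    by blast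
  have "z = (\<Sum>k<Suc N. sym_term scale d k ((x(N := y)) k))"
    using eq by (simp add: z algebra_simps)
  moreover have "\<forall>k<Suc N. (x(N := y)) k \<in> C" using x y by (simp add: less_Suc_eq)
  ultimately show ?case by blast
qed simp

lemma G_space_eq_normal_space: "G_space scale C d m = NS (Suc m)"
proof (intro equalityI subsetI)
  fix z assume "z \<in> G_space scale C d m"
  then obtain f where f: "\<forall>k\<le>m. f k \<in> sym_term scale d k ` C" and z: "z = (\<Sum>k\<le>m. f k)"
    by (auto simp: G_space_def F_space_def)
  from f obtain x where x: "\<forall>k\<le>m. x k \<in> C \<and> f k = sym_term scale d k (x k)"
    unfolding image_iff Bex_def by metis
  then have "z = (\<Sum>k<Suc m. sym_term scale d k (x k))"
    unfolding z lessThan_Suc_atMost by (intro sum.cong) auto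
  then show "z \<in> NS (Suc m)"
    using sum_sym_terms_normal_space[of "Suc m" x] x by (simp add: less_Suc_eq_le)
next
  fix z assume "z \<in> NS (Suc m)"
  then obtain x where "\<forall>k\<le>m. x k \<in> C" "z = (\<Sum>k\<le>m. sym_term scale d k (x k))"
    using normal_space_sym_terms[of z "Suc m"] unfolding lessThan_Suc_atMost less_Suc_eq_le
    by blast
  then show "z \<in> G_space scale C d m" unfolding G_space_def F_space_def by blast
qed

section \<open>From degree bounds to heights\<close>

lemma height_rep_exists:
  "(\<forall>k<N. x k \<in> C) \<Longrightarrow> (\<Sum>k<N. sym_term scale d k (x k)) \<noteq> 0
    \<Longrightarrow> \<exists>m<N. height_rep scale C d (\<Sum>k<N. sym_term scale d k (x k)) m x"
proof (induction N)
  case (Suc N)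
  show ?case
  proof (cases "x N = 0")
    \<comment> \<open>A vanishing top coefficient is dropped, so \<open>m\<close> ends up as the
      last index below the bound with \<open>x m\<close> nonzero.\<close>
    case True
    then have "(\<Sum>k<Suc N. sym_term scale d k (x k)) = (\<Sum>k<N. sym_term scale d k (x k))"
      by (simp add: sym_term_def)
    then show ?thesis using Suc by (metis less_Suc_eq)
  next
    case False
    then have "height_rep scale C d (\<Sum>k<Suc N. sym_term scale d k (x k)) N x"
      using Suc.prems(1) unfolding height_rep_def lessThan_Suc_atMost less_Suc_eq_le by blast
    then show ?thesis by blast
  qed
qed simp

text \<open>\<open>height\<close> is a least top index, so a single representation bounds it from
  above. The \<open>max 0\<close> covers \<open>N = 0\<close>, where \<open>z = 0\<close> has height
  \<open>-1\<close>.\<close>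

lemma height_less_normal_space:
  assumes "z \<in> NS N"
  shows "height scale C d z < max 0 (int N)"
proof (cases "z = 0")
  case False
  obtain x where "\<forall>k<N. x k \<in> C" and "z = (\<Sum>k<N. sym_term scale d k (x k))"
    using normal_space_sym_terms[OF assms] by blast
  with False obtain m where "m < N" "height_rep scale C d z m x"
    using height_rep_exists by metis
  then have "(LEAST m. \<exists>x. height_rep scale C d z m x) < N"
    using Least_le[of "\<lambda>m. \<exists>x. height_rep scale C d z m x" m] by fastforce
  then show ?thesis using False by (simp add: height_def)
qed (simp add: height_def)

end

theorem corollary6:
  fixes scale :: "rat \<Rightarrow> 'a::ring_1 \<Rightarrow> 'a"
    and C :: "'a set" and d :: 'a
    and W :: bracketing and n :: nat
    and a :: "nat \<Rightarrow> 'a" and k :: "nat \<Rightarrow> nat"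
  assumes "rat_algebra scale"
    and "commutative_subalgebra scale C"
    and "d \<in> lie_idealiser C - C"
    and "features W n"
    and "\<And>i. i \<in> {1..n} \<Longrightarrow> a i \<in> G_space scale C d (k i)"
  shows "eval_commutator a W \<in> (\<Union>m. G_space scale C d m) \<and>
         height scale C d (eval_commutator a W)
           \<le> max (-1) ((\<Sum>i=1..n. int (k i)) - int n + 1)"
proof -
  interpret rat_algebra scale by (fact assms(1))
  interpret idealised_algebra scale C d
    by unfold_locales (use assms(2,3) in auto)
  \<comment> \<open>One more than the claimed height bound, since \<open>NS\<close> is indexed by
    strict bounds; \<open>nat\<close> clips negative values to the zero space.\<close>
  define N where "N = nat ((\<Sum>i=1..n. int (k i)) - int n + 2)"
  \<comment> \<open>Each letter occurs exactly once, so the list sum is a sum over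
    \<open>{1..n}\<close>.\<close>
  have "(\<Sum>i\<leftarrow>letters W. int (k i) - 1) = (\<Sum>i=1..n. int (k i) - 1)"
    using assms(4) sum_list_distinct_conv_sum_set[of "letters W"] by (simp add: features_def)
  then have "(\<Sum>i\<leftarrow>letters W. int (k i) - 1) + 2 = (\<Sum>i=1..n. int (k i)) - int n + 2"
    by (simp add: sum_subtractf)
  then have W: "eval_commutator a W \<in> NS N"
    using eval_commutator_normal_space[of W a k] assms(4,5)
    unfolding G_space_eq_normal_space features_def N_def by simp
  \<comment> \<open>For membership in the union, the generous index \<open>N\<close> avoids treating
    \<open>N = 0\<close> separately.\<close>
  have "eval_commutator a W \<in> G_space scale C d N"
    unfolding G_space_eq_normal_space using W normal_space_mono[of N "Suc N"] by auto
  moreover have "height scale C d (eval_commutator a W)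
      \<le> max (-1) ((\<Sum>i=1..n. int (k i)) - int n + 1)"
    using height_less_normal_space[OF W] unfolding N_def by linarith
  ultimately show ?thesis by blast
qed

end
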